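(* Let $\mathcal{C}$ be an optimization algorithm satisfying assumptions A1–A4 of the context, let $f:\mathbb{R}^n\to\mathbb{R}$ be bounded from below, and let $x^*\in X$ be a discrete local minimizer of $f$. Let $F:\mathbb{R}^n\to\mathbb{R}$ be a function bounded from below which (restricted to $X$) is a discrete filled function of $f$ at $x^*$ in the usual sense, and define $$\hat F(x)=F(x)+|F(x)|\sum_{i=1}^n\sin^2(\pi x_i),\qquad x\in\mathbb{R}^n.$$ Then $\hat F$ is a filled function of $f$ at $x^*$ with respect to $\mathcal{C}$.
   Context: Let $e_1,\dots,e_n$ be the standard basis vectors of $\mathbb{R}^n$, $D=\{\pm e_i: i=1,\dots,n\}$, and let $X=\{x\in\mathbb{Z}^n: a_i\le x_i\le b_i,\ i=1,\dots,n\}$ be an integer box. For $x\in\mathbb{Z}^n$ put $\mathcal{N}(x)=\{x\pm e_i: i=1,\dots,n\}\cup\{x\}$. A discrete local minimizer of a function $g$ is a point $y\in X$ with $g(y)\le g(x)$ for all $x\in\mathcal{N}(y)\cap X$; $y\in X$ is a strict discrete local maximizer of $g$ over $X$ if $g(x)<g(y)$ for all $x\in(\mathcal{N}(y)\cap X)\setminus\{y\}$. Rounding: for $x\in\mathbb{R}^n$, $[x]\in\mathbb{Z}^n$ has entries $[x]_i=x_i$ if $x_i\in\mathbb{Z}$ and $[x]_i=\lfloor x_i+x_i/(2|x_i|)\rfloor$ if $x_i\notin\mathbb{Z}$. Discrete path: a discrete path in $X$ between two points of $X$ is a finite sequence of pairwise distinct points of $X$ starting at the first point and ending at the second, consecutive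 points being at Euclidean distance $1$. u-basin: the discrete steepest descent algorithm for $f$ over $X$ started at $x\in X$ stops if $x$ is a discrete local minimizer of $f$; otherwise it replaces $x$ by $x+d^*$, where $d^*\in D$ satisfies $x+d^*\in X$, $f(x+d^* )<f(x)$, and $f(x+d^* )\le f(x+d)$ for all $d\in D$ with $x+d\in X$ and $f(x+d)<f(x)$ (ties resolved by a fixed rule), and repeats. The u-basin (usual basin) of $f$ at a discrete local minimizer $y$ is the set of all $x\in X$ from which this algorithm converges to $y$. If $U^*,U^{**}$ are u-basins of $f$ at $x^*,x^{**}$, then $U^{**}$ is lower than $U^*$ if $f(x^{**})\le f(x^* )$ and higher than $U^*$ if $f(x^{**})>f(x^* )$. Discrete filled function in the usual sense: with $U^*$ the u-basin of $f$ at $x^*$, $F$ is a discrete filled function of $f$ at $x^*$ in the usual sense if D1: $x^*$ is a strict discrete local maximizer of $F$ over $X$; D2: $F$ has discrete local minimizers neither in $U^*$ nor in any u-basin of $f$ higher than $U^*$; D3: if $f$ has a u-basin $U^{**}$ at $x^{**}$ lower than $U^*$, then there are a discrete path in $X$ from $x^*$ to $x^{**}$ and a point $x'\in U^{**}$ on this path that minimizes $F$ over the points of the path. Algorithm: $\mathcal{C}$ takes a function $g:\mathbb{R}^n\to\mathbb{R}$ bounded from below and a starting point $x_0\in\mathbb{R}^n$ and returns a point of $\mathbb{R}^n$; $x\leftarrow\mathcal{C}(g,x_0)$ means that $x$ is the returned point. The discrete basin (with respect to $\mathcal{C}$) of $f$ at a discrete local minimizer $y$ is $\{x\in\mathbb{Z}^n: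 x'\leftarrow\mathcal{C}(f,x)\text{ and }[x']=y\}$. The assumptions are: A1: $\mathcal{C}$ is deterministic (the returned point is a function of $(g,x_0)$). A2: if $x\leftarrow\mathcal{C}(g,x_0)$ then $g(x)\le g(x_0)$. A3: if $x_0\in\mathbb{Z}^n$ and $x\leftarrow\mathcal{C}(g,x_0)$, then either $x_0=x$, or there is $d\in D$ such that $x\leftarrow\mathcal{C}(g,x_0+d)$ and $\|x_0+d-x\|<\|x_0-x\|$. A4: if $U$ is the u-basin of $f$ at $y$ and $x\in U$, then $x$ belongs to the discrete basin of $f$ at some discrete local minimizer $y_b$ with $f(y_b)\le f(y)$. Filled function with respect to $\mathcal{C}$: a function $G:\mathbb{R}^n\to\mathbb{R}$ is a filled function of $f$ at $x^*$ with respect to $\mathcal{C}$ if DC1: $x^*$ is a strict discrete local maximizer of $G$ over $X$; DC2: for any $x\in\mathbb{R}^n$, if $x'\leftarrow\mathcal{C}(G,x)$ and $[x']$ is a discrete local minimizer of $G$, then either $x'=x$, or $x''\leftarrow\mathcal{C}(f,[x'])$ implies $f([x''])\le f(x^* )$. *)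

theory Defs
  imports "HOL-Analysis.Analysis"
begin

text \<open>Integer points are the points of \<^typ>\<open>real ^ 'n\<close> with integer coordinates, so that
  functions on the whole space can be evaluated at them without coercions.\<close>

definition int_points :: "(real ^ 'n) set" where
  "int_points = {x. \<forall>i. x $ i \<in> \<int>}"

definition int_box :: "int ^ 'n \<Rightarrow> int ^ 'n \<Rightarrow> (real ^ 'n) set" where
  "int_box a b = {x \<in> int_points. \<forall>i. real_of_int (a $ i) \<le> x $ i \<and> x $ i \<le> real_of_int (b $ i)}"

definition directions :: "(real ^ 'n) set" where
  "directions = (\<Union>i. {axis i 1, - axis i 1})"

definition neighbourhood :: "real ^ 'n \<Rightarrow> (real ^ 'n) set" where
  "neighbourhood x = (\<Union>i. {x + axis i 1, x - axis i 1}) \<union> {x}"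

definition discrete_local_minimizer ::
  "(real ^ 'n) set \<Rightarrow> (real ^ 'n \<Rightarrow> real) \<Rightarrow> real ^ 'n \<Rightarrow> bool" where
  "discrete_local_minimizer X g y \<longleftrightarrow> y \<in> X \<and> (\<forall>x \<in> neighbourhood y \<inter> X. g y \<le> g x)"

definition strict_discrete_local_maximizer ::
  "(real ^ 'n) set \<Rightarrow> (real ^ 'n \<Rightarrow> real) \<Rightarrow> real ^ 'n \<Rightarrow> bool" where
  "strict_discrete_local_maximizer X g y \<longleftrightarrow>
     y \<in> X \<and> (\<forall>x \<in> (neighbourhood y \<inter> X) - {y}. g x < g y)"

definition round_vec :: "real ^ 'n \<Rightarrow> real ^ 'n" where
  "round_vec x =
     (\<chi> i. if x $ i \<in> \<int> then x $ i else real_of_int \<lfloor>x $ i + x $ i / (2 * \<bar>x $ i\<bar>)\<rfloor>)"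

definition discrete_path ::
  "(real ^ 'n) set \<Rightarrow> real ^ 'n \<Rightarrow> real ^ 'n \<Rightarrow> (real ^ 'n) list \<Rightarrow> bool" where
  "discrete_path X x y p \<longleftrightarrow>
     p \<noteq> [] \<and> hd p = x \<and> last p = y \<and> distinct p \<and> set p \<subseteq> X \<and>
     (\<forall>k. Suc k < length p \<longrightarrow> dist (p ! k) (p ! Suc k) = 1)"

definition steepest_directions ::
  "(real ^ 'n) set \<Rightarrow> (real ^ 'n \<Rightarrow> real) \<Rightarrow> real ^ 'n \<Rightarrow> (real ^ 'n) set" where
  "steepest_directions X f x =
     {d \<in> directions. x + d \<in> X \<and> f (x + d) < f x \<and>
        (\<forall>d' \<in> directions. x + d' \<in> X \<and> f (x + d') < f x \<longrightarrow> f (x + d) \<le> f (x + d'))}"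

text \<open>A tie-breaking rule selects, at each point, one element of every nonempty set of candidate
  directions. The rule is a parameter of the steepest descent algorithm and hence of all u-basins.\<close>

definition tie_breaking_rule :: "(real ^ 'n \<Rightarrow> (real ^ 'n) set \<Rightarrow> real ^ 'n) \<Rightarrow> bool" where
  "tie_breaking_rule r \<longleftrightarrow> (\<forall>x S. S \<noteq> {} \<and> S \<subseteq> directions \<longrightarrow> r x S \<in> S)"

inductive descent_converges ::
  "(real ^ 'n) set \<Rightarrow> (real ^ 'n \<Rightarrow> (real ^ 'n) set \<Rightarrow> real ^ 'n) \<Rightarrow> (real ^ 'n \<Rightarrow> real) \<Rightarrow>
   real ^ 'n \<Rightarrow> real ^ 'n \<Rightarrow> bool"
  for X r f where
  stop: "discrete_local_minimizer X f x \<Longrightarrow> descent_converges X r f x x"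
| step: "x \<in> X \<Longrightarrow> \<not> discrete_local_minimizer X f x \<Longrightarrow>
    descent_converges X r f (x + r x (steepest_directions X f x)) y \<Longrightarrow>
    descent_converges X r f x y"

definition u_basin ::
  "(real ^ 'n) set \<Rightarrow> (real ^ 'n \<Rightarrow> (real ^ 'n) set \<Rightarrow> real ^ 'n) \<Rightarrow> (real ^ 'n \<Rightarrow> real) \<Rightarrow>
   real ^ 'n \<Rightarrow> (real ^ 'n) set" where
  "u_basin X r f y = {x \<in> X. descent_converges X r f x y}"

definition usual_discrete_filled_function ::
  "(real ^ 'n) set \<Rightarrow> (real ^ 'n \<Rightarrow> (real ^ 'n) set \<Rightarrow> real ^ 'n) \<Rightarrow> (real ^ 'n \<Rightarrow> real) \<Rightarrow>
   real ^ 'n \<Rightarrow> (real ^ 'n \<Rightarrow> real) \<Rightarrow> bool" where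
  "usual_discrete_filled_function X r f xs F \<longleftrightarrow>
     strict_discrete_local_maximizer X F xs \<and>
     (\<forall>z \<in> u_basin X r f xs. \<not> discrete_local_minimizer X F z) \<and>
     (\<forall>y. discrete_local_minimizer X f y \<and> f y > f xs \<longrightarrow>
        (\<forall>z \<in> u_basin X r f y. \<not> discrete_local_minimizer X F z)) \<and>
     (\<forall>y. discrete_local_minimizer X f y \<and> f y \<le> f xs \<longrightarrow>
        (\<exists>p x'. discrete_path X xs y p \<and> x' \<in> u_basin X r f y \<and> x' \<in> set p \<and>
          (\<forall>z \<in> set p. F x' \<le> F z)))"

text \<open>An optimization algorithm is a relation \<open>C\<close>, where \<open>C g x0 x\<close> means that \<open>x\<close> is returned for
  the objective \<open>g\<close> and the starting point \<open>x0\<close>. Only objectives that are bounded from below are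
  admissible inputs; nothing is assumed about the others.\<close>

type_synonym 'n algorithm = "(real ^ 'n \<Rightarrow> real) \<Rightarrow> real ^ 'n \<Rightarrow> real ^ 'n \<Rightarrow> bool"

definition returns_point :: "'n::finite algorithm \<Rightarrow> bool" where
  "returns_point C \<longleftrightarrow> (\<forall>g x0. bdd_below (range g) \<longrightarrow> (\<exists>x. C g x0 x))"

definition deterministic :: "'n::finite algorithm \<Rightarrow> bool" where
  "deterministic C \<longleftrightarrow>
     (\<forall>g x0 x y. bdd_below (range g) \<longrightarrow> C g x0 x \<longrightarrow> C g x0 y \<longrightarrow> x = y)"

definition non_increasing :: "'n::finite algorithm \<Rightarrow> bool" where
  "non_increasing C \<longleftrightarrow> (\<forall>g x0 x. bdd_below (range g) \<longrightarrow> C g x0 x \<longrightarrow> g x \<le> g x0)"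

definition neighbour_consistent :: "'n::finite algorithm \<Rightarrow> bool" where
  "neighbour_consistent C \<longleftrightarrow>
     (\<forall>g x0 x. bdd_below (range g) \<longrightarrow> x0 \<in> int_points \<longrightarrow> C g x0 x \<longrightarrow>
        x0 = x \<or> (\<exists>d \<in> directions. C g (x0 + d) x \<and> norm (x0 + d - x) < norm (x0 - x)))"

definition discrete_basin ::
  "'n::finite algorithm \<Rightarrow> (real ^ 'n \<Rightarrow> real) \<Rightarrow> real ^ 'n \<Rightarrow> (real ^ 'n) set" where
  "discrete_basin C f y = {x \<in> int_points. \<exists>x'. C f x x' \<and> round_vec x' = y}"

definition basin_compatible ::
  "(real ^ 'n) set \<Rightarrow> (real ^ 'n \<Rightarrow> (real ^ 'n) set \<Rightarrow> real ^ 'n) \<Rightarrow> 'n::finite algorithm \<Rightarrow>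
   (real ^ 'n \<Rightarrow> real) \<Rightarrow> bool" where
  "basin_compatible X r C f \<longleftrightarrow>
     (\<forall>y x. discrete_local_minimizer X f y \<longrightarrow> x \<in> u_basin X r f y \<longrightarrow>
        (\<exists>yb. discrete_local_minimizer X f yb \<and> x \<in> discrete_basin C f yb \<and> f yb \<le> f y))"

definition filled_function_wrt ::
  "(real ^ 'n) set \<Rightarrow> 'n::finite algorithm \<Rightarrow> (real ^ 'n \<Rightarrow> real) \<Rightarrow> real ^ 'n \<Rightarrow>
   (real ^ 'n \<Rightarrow> real) \<Rightarrow> bool" where
  "filled_function_wrt X C f xs G \<longleftrightarrow>
     strict_discrete_local_maximizer X G xs \<and>
     (\<forall>x x'. C G x x' \<longrightarrow> discrete_local_minimizer X G (round_vec x') \<longrightarrow>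
        x' = x \<or> (\<forall>x''. C f (round_vec x') x'' \<longrightarrow> f (round_vec x'') \<le> f xs))"

definition sine_modification :: "(real ^ 'n \<Rightarrow> real) \<Rightarrow> real ^ 'n \<Rightarrow> real" where
  "sine_modification F x = F x + \<bar>F x\<bar> * (\<Sum>i\<in>UNIV. (sin (pi * x $ i))\<^sup>2)"

end

theory Submission
  imports Defs
begin

text \<open>At integer points the sine term vanishes, so the modified function inherits the strict local
  maximizer and all discrete local minimizers of \<open>F\<close>. A discrete local minimizer of \<open>F\<close> lies in some
  u-basin of \<open>f\<close>, because steepest descent terminates on a finite box; this basin cannot be higher
  than the one at \<open>x\<^sup>*\<close>, so compatibility of the basins bounds what the algorithm finds from there.\<close>

text \<open>Each coordinate ranges over a finite integer interval, so the box lies in the image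
  under \<open>vec_lambda\<close> of a finite product of such intervals.\<close>

lemma finite_int_box: "finite (int_box a b)"
proof -
  let ?P = "\<Pi>\<^sub>E i\<in>UNIV. real_of_int ` {a $ i..b $ i}"
  have "int_box a b \<subseteq> vec_lambda ` ?P"
  proof
    fix x assume x: "x \<in> int_box a b"
    have "x $ i \<in> real_of_int ` {a $ i..b $ i}" for i
    proof -
      have "x $ i \<in> \<int>"
        using x by (simp add: int_box_def int_points_def)
      then obtain k where k: "x $ i = real_of_int k"
        by (rule Ints_cases)
      have "real_of_int (a $ i) \<le> x $ i" "x $ i \<le> real_of_int (b $ i)"
        using x by (simp_all add: int_box_def)
      then show ?thesis
        by (simp add: k)
    qed
    then have "vec_nth x \<in> ?P"
      by (simp add: PiE_UNIV_domain)
    then show "x \<in> vec_lambda ` ?P"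
      by (metis image_eqI vec_nth_inverse)
  qed
  moreover have "finite ?P"
    by (intro finite_PiE) auto
  ultimately show ?thesis
    by (meson finite_imageI finite_subset)
qed

lemma finite_directions: "finite directions"
  by (simp add: directions_def)

text \<open>A neighbour violating minimality yields a descent direction, and among the finitely many
  descent directions one attains the least value of \<open>f\<close>.\<close>

lemma steepest_directions_nonempty:
  assumes "x \<in> X" "\<not> discrete_local_minimizer X f x"
  shows "steepest_directions X f x \<noteq> {}"
proof -
  let ?S = "{d \<in> directions. x + d \<in> X \<and> f (x + d) < f x}"
  obtain z where z: "z \<in> neighbourhood x" "z \<in> X" "f z < f x"
    using assms by (auto simp: discrete_local_minimizer_def not_le)
  then have "z - x \<in> directions"
    by (auto simp: neighbourhood_def directions_def)
  with z have "z - x \<in> ?S"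
    by simp
  then have "?S \<noteq> {}"
    by blast
  moreover have "finite ?S"
    by (simp add: finite_directions)
  ultimately obtain d where "is_arg_min (\<lambda>d. f (x + d)) (\<lambda>d. d \<in> ?S) d"
    using ex_is_arg_min_if_finite by blast
  then show ?thesis
    by (auto simp: steepest_directions_def is_arg_min_linorder)
qed

text \<open>Every step strictly lowers \<open>f\<close>, so the number of points of \<open>X\<close>
  with a smaller value drops; this number is the induction measure.\<close>

lemma descent_terminates:
  assumes "finite X" "tie_breaking_rule r" "x \<in> X"
  shows "\<exists>y. discrete_local_minimizer X f y \<and> descent_converges X r f x y"
  using \<open>x \<in> X\<close>
proof (induction "card {z \<in> X. f z < f x}" arbitrary: x rule: less_induct)
  case less
  show ?case
  proof (cases "discrete_local_minimizer X f x")
    case True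
    then show ?thesis
      by (blast intro: descent_converges.stop)
  next
    case False
    let ?x = "x + r x (steepest_directions X f x)"
    have "steepest_directions X f x \<subseteq> directions"
      by (auto simp: steepest_directions_def)
    then have "r x (steepest_directions X f x) \<in> steepest_directions X f x"
      using assms(2) steepest_directions_nonempty[OF less.prems False]
      by (auto simp: tie_breaking_rule_def)
    then have x': "?x \<in> X" "f ?x < f x"
      by (auto simp: steepest_directions_def)
    \<comment> \<open>The inclusion is strict because \<open>?x\<close> itself belongs only to the
      right-hand set.\<close>
    then have "{z \<in> X. f z < f ?x} \<subset> {z \<in> X. f z < f x}"
      by auto
    then have "card {z \<in> X. f z < f ?x} < card {z \<in> X. f z < f x}"
      using assms(1) by (intro psubset_card_mono) auto
    then obtain y where "discrete_local_minimizer X f y" "descent_converges X r f ?x y"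
      using less.hyps x'(1) by blast
    then show ?thesis
      using descent_converges.step[OF less.prems False] by blast
  qed
qed

lemma sine_modification_int_points:
  assumes "x \<in> int_points"
  shows "sine_modification F x = F x"
proof -
  have "sin (pi * x $ i) = 0" for i
    using assms by (simp add: int_points_def sin_times_pi_eq_0 mult.commute[of pi])
  then show ?thesis
    by (simp add: sine_modification_def)
qed

text \<open>Neighbours outside \<open>X\<close> are never compared, so agreement on \<open>X\<close>
  suffices to pass between \<open>sine_modification F\<close> and \<open>F\<close>.\<close>

lemma discrete_local_minimizer_cong:
  assumes "\<And>x. x \<in> X \<Longrightarrow> g x = h x"
  shows "discrete_local_minimizer X g y \<longleftrightarrow> discrete_local_minimizer X h y"
  using assms by (auto simp: discrete_local_minimizer_def)

lemma strict_discrete_local_maximizer_cong: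
  assumes "\<And>x. x \<in> X \<Longrightarrow> g x = h x"
  shows "strict_discrete_local_maximizer X g y \<longleftrightarrow> strict_discrete_local_maximizer X h y"
  using assms by (auto simp: strict_discrete_local_maximizer_def)

theorem theorem3:
  fixes a b :: "int ^ 'n"
    and X :: "(real ^ 'n) set"
    and r :: "real ^ 'n \<Rightarrow> (real ^ 'n) set \<Rightarrow> real ^ 'n"
    and C :: "'n algorithm"
    and f F :: "real ^ 'n \<Rightarrow> real"
    and xs :: "real ^ 'n"
  assumes "X = int_box a b"
    and "tie_breaking_rule r"
    and "returns_point C"
    and "deterministic C"
    and "non_increasing C"
    and "neighbour_consistent C"
    and "basin_compatible X r C f"
    and "bdd_below (range f)"
    and "discrete_local_minimizer X f xs"
    and "bdd_below (range F)"
    and "usual_discrete_filled_function X r f xs F"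
  shows "filled_function_wrt X C f xs (sine_modification F)"
proof -
  have eq: "sine_modification F x = F x" if "x \<in> X" for x
    using that assms(1) by (simp add: int_box_def sine_modification_int_points)
  \<comment> \<open>Here \<open>z\<close> stands for the rounded output \<open>round_vec x'\<close>
    of a run on the modified function.\<close>
  have "f (round_vec x'') \<le> f xs"
    if min: "discrete_local_minimizer X (sine_modification F) z" and run: "C f z x''" for z x''
  proof -
    have F_min: "discrete_local_minimizer X F z"
      using min discrete_local_minimizer_cong[of X "sine_modification F" F, OF eq] by blast
    then have "z \<in> X"
      by (simp add: discrete_local_minimizer_def)
    then obtain y where y: "discrete_local_minimizer X f y" "z \<in> u_basin X r f y"
      using descent_terminates[of X r z f] assms(1,2) finite_int_box
      by (auto simp: u_basin_def)
    \<comment> \<open>Otherwise \<open>z\<close> would be a minimizer of \<open>F\<close> in a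
      u-basin higher than that of \<open>xs\<close>, which condition D2 forbids.\<close>
    then have "f y \<le> f xs"
      using assms(11) F_min by (force simp: usual_discrete_filled_function_def)
    moreover obtain yb where "z \<in> discrete_basin C f yb" "f yb \<le> f y"
      using assms(7) y by (auto simp: basin_compatible_def)
    \<comment> \<open>Membership in the discrete basin gives some run from \<open>z\<close> that
      rounds to \<open>yb\<close>; determinism identifies its result with
      \<open>x''\<close>.\<close>
    moreover from this have "round_vec x'' = yb"
      using assms(4,8) run by (auto simp: discrete_basin_def deterministic_def)
    ultimately show ?thesis
      by simp
  qed
  moreover have "strict_discrete_local_maximizer X (sine_modification F) xs"
    using assms(11) strict_discrete_local_maximizer_cong[of X "sine_modification F" F, OF eq]
    by (auto simp: usual_discrete_filled_function_def)
  ultimately show ?thesis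
    by (auto simp: filled_function_wrt_def)
qed

end
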